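(* Let $P$ be a set of $n\ge 1$ red and $n$ blue points in convex position, and let $i,j\in P$. Then $i$ and $j$ form a feasible pair if and only if they have different colors and $\mathcal{O}(i)=\mathcal{O}(j)$.
   Context: The points of $P$ are the vertices of a convex polygon, labelled $0,1,\ldots,2n-1$ in counterclockwise (positive) direction; points are identified with their indices, taken modulo $2n$. A matching of $P$ is a perfect matching by straight line segments, each having one red and one blue endpoint, such that no two segments cross. A pair $(i,j)$ is feasible if some matching of $P$ contains the segment $ij$. For $i\in P$, $o(i)$ is the first point $j$ encountered starting from $i$ in the positive direction such that $(i,j)$ is feasible; $o:P\to P$ is a well-defined bijection. The orbit of $i$ is $\mathcal{O}(i)=\{o^k(i):k\in\mathbb{Z}\}$. *)

theory Defs
  imports "HOL-Analysis.Analysis"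
begin

definition convex_position :: "(real^2) set \<Rightarrow> bool" where
  "convex_position P \<longleftrightarrow> finite P \<and> (\<forall>x\<in>P. x extreme_point_of (convex hull P))"

text \<open>Twice the signed area of the triangle \<open>a b c\<close>; positive iff \<open>a, b, c\<close> make a strict left turn.\<close>
definition orient :: "real^2 \<Rightarrow> real^2 \<Rightarrow> real^2 \<Rightarrow> real" where
  "orient a b c = (b$1 - a$1) * (c$2 - a$2) - (b$2 - a$2) * (c$1 - a$1)"

definition ccw_labelling :: "nat \<Rightarrow> (nat \<Rightarrow> real^2) \<Rightarrow> (real^2) set \<Rightarrow> bool" where
  "ccw_labelling N p P \<longleftrightarrow> bij_betw p {..<N} P \<and>
     (\<forall>i j k. i < j \<and> j < k \<and> k < N \<longrightarrow> orient (p i) (p j) (p k) > 0)"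

text \<open>
  An edge is the two-element set of its endpoints, and its segment is the convex hull of that set.
  As distinct edges of a perfect matching share no endpoint and no three points in convex position
  are collinear, two such segments cross iff they meet.
\<close>
definition matching :: "(real^2) set \<Rightarrow> (real^2) set \<Rightarrow> (real^2) set set \<Rightarrow> bool" where
  "matching R B M \<longleftrightarrow> partition_on (R \<union> B) M \<and>
     (\<forall>e\<in>M. \<exists>r\<in>R. \<exists>b\<in>B. e = {r, b}) \<and>
     (\<forall>e\<in>M. \<forall>f\<in>M. e \<noteq> f \<longrightarrow> convex hull e \<inter> convex hull f = {})"

definition feasible :: "(real^2) set \<Rightarrow> (real^2) set \<Rightarrow> real^2 \<Rightarrow> real^2 \<Rightarrow> bool" where
  "feasible R B x y \<longleftrightarrow> (\<exists>M. matching R B M \<and> {x, y} \<in> M)"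

definition first_feasible ::
    "nat \<Rightarrow> (nat \<Rightarrow> real^2) \<Rightarrow> (real^2) set \<Rightarrow> (real^2) set \<Rightarrow> nat \<Rightarrow> nat" where
  "first_feasible N p R B i =
     (i + (LEAST d. 0 < d \<and> feasible R B (p i) (p ((i + d) mod N)))) mod N"

text \<open>Integer iterates of a bijection \<open>f\<close> of \<open>A\<close> onto itself.\<close>
definition int_iterate :: "'a set \<Rightarrow> ('a \<Rightarrow> 'a) \<Rightarrow> int \<Rightarrow> 'a \<Rightarrow> 'a" where
  "int_iterate A f k = (if k \<ge> 0 then f ^^ nat k else inv_into A f ^^ nat (- k))"

definition feasible_orbit ::
    "nat \<Rightarrow> (nat \<Rightarrow> real^2) \<Rightarrow> (real^2) set \<Rightarrow> (real^2) set \<Rightarrow> nat \<Rightarrow> nat set" where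
  "feasible_orbit N p R B i = range (\<lambda>k. int_iterate {..<N} (first_feasible N p R B) k i)"

end

theory Submission imports Defs begin

text \<open>
  Read the colours as steps \<open>+1\<close> (red) and \<open>-1\<close> (blue) of a closed walk on the integers, and let the
  level of a point be the lower end of its step. A chord \<open>ij\<close> lies in a matching iff its ends have
  different colours and the points strictly between them are balanced, that is, iff \<open>i\<close> and \<open>j\<close> are
  opposite steps of the same level. Between two equal steps of one level the walk must take the
  opposite step of that level, so \<open>o\<close> never jumps over a point of its own level, and the orbits of
  \<open>o\<close> are exactly the level classes.
\<close>

section \<open>Segments in the plane\<close>

lemma orient_degenerate [simp]: "orient a b a = 0" "orient a b b = 0"
  by (simp_all add: orient_def)

lemma orient_rotate: "orient b c a = orient a b c"
  by (simp add: orient_def algebra_simps)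

lemma orient_swap: "orient a c b = - orient a b c"
  by (simp add: orient_def algebra_simps)

lemma orient_affine:
  assumes "u + v = 1"
  shows "orient a b (u *\<^sub>R x + v *\<^sub>R y) = u * orient a b x + v * orient a b y"
proof -
  have u: "u = 1 - v" using assms by simp
  show ?thesis unfolding u by (simp add: orient_def algebra_simps)
qed

text \<open>The map \<open>orient a b\<close> is affine: it vanishes on the first segment, and on
  the second it keeps the common strict sign of its values at \<open>x\<close> and
  \<open>y\<close>.\<close>

lemma convex_hull_2_disjoint:
  assumes "orient a b x > 0 \<and> orient a b y > 0 \<or> orient a b x < 0 \<and> orient a b y < 0"
  shows "convex hull {a, b} \<inter> convex hull {x, y} = {}"
proof -
  have "orient a b z = 0" if "z \<in> convex hull {a, b}" for z
    using that by (auto simp: convex_hull_2 orient_affine)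
  moreover have "orient a b z \<noteq> 0" if z: "z \<in> convex hull {x, y}" for z
  proof -
    obtain u v where uv: "u \<ge> 0" "v \<ge> 0" "u + v = 1" "z = u *\<^sub>R x + v *\<^sub>R y"
      using z unfolding convex_hull_2 by blast
    have *: "u * s + v * t > 0" if "s > 0" "t > 0" for s t :: real
    proof (cases "u = 0")
      case False
      then show ?thesis using uv that by (simp add: add_pos_nonneg)
    qed (use uv that in auto)
    show ?thesis
      using assms *[of "orient a b x" "orient a b y"] *[of "- orient a b x" "- orient a b y"] uv
      by (auto simp: orient_affine)
  qed
  ultimately show ?thesis by blast
qed

text \<open>Each segment has its ends strictly on opposite sides of the line through the other, so
  one explicit point is a convex combination of both pairs of ends.\<close>

lemma convex_hull_2_meet:
  assumes "orient a b x < 0" "orient a b y > 0" "orient x y a > 0" "orient x y b < 0"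
  shows "convex hull {a, b} \<inter> convex hull {x, y} \<noteq> {}"
proof -
  \<comment> \<open>\<open>D\<close> is the cross product of \<open>b - a\<close> and
    \<open>y - x\<close>; by \<open>D'\<close> it is a common denominator for the weights on both
    segments.\<close>
  define D where "D = orient a b y - orient a b x"
  have D: "D > 0" using assms by (simp add: D_def)
  have D': "D = orient x y a - orient x y b"
    by (simp add: D_def orient_def algebra_simps)
  have in_hull: "u *\<^sub>R q + v *\<^sub>R r \<in> convex hull {q, r}"
    if "u \<ge> 0" "v \<ge> 0" "u + v = 1" for u v and q r :: "real^2"
    using that unfolding convex_hull_2 by blast
  \<comment> \<open>\<open>z\<close> is the point of the line through \<open>x\<close> and
    \<open>y\<close> at which \<open>orient a b\<close> vanishes.\<close>
  define z where "z = (orient a b y / D) *\<^sub>R x + (- orient a b x / D) *\<^sub>R y"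
  have "orient a b y / D + - orient a b x / D = 1"
    using D by (simp add: D_def flip: diff_divide_distrib)
  then have "z \<in> convex hull {x, y}"
    unfolding z_def using assms D by (intro in_hull) (auto simp: divide_nonpos_pos)
  moreover have "(- orient x y b) / D + orient x y a / D = 1"
    using D by (simp add: D' flip: diff_divide_distrib add_divide_distrib)
  then have "(- orient x y b / D) *\<^sub>R a + (orient x y a / D) *\<^sub>R b \<in> convex hull {a, b}"
    using assms D by (intro in_hull) (auto simp: divide_nonpos_pos)
  moreover have "orient a b y *\<^sub>R x + (- orient a b x) *\<^sub>R y =
      (- orient x y b) *\<^sub>R a + orient x y a *\<^sub>R b"
    by (simp add: orient_def vec_eq_iff forall_2 algebra_simps)
  then have "D *\<^sub>R z = D *\<^sub>R ((- orient x y b / D) *\<^sub>R a + (orient x y a / D) *\<^sub>R b)"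
    using D by (simp add: z_def scaleR_add_right del: scaleR_minus_left)
  then have "z = (- orient x y b / D) *\<^sub>R a + (orient x y a / D) *\<^sub>R b"
    using D by simp
  ultimately show ?thesis by auto
qed

section \<open>Noncrossing matchings of balanced sets\<close>

locale bichromatic_polygon =
  fixes N :: nat and R B :: "(real^2) set" and p :: "nat \<Rightarrow> real^2"
  assumes N_pos: "0 < N"
    and disjoint_colours: "R \<inter> B = {}"
    and finite_colours: "finite R" "finite B"
    and balanced: "card R = card B"
    and labelling: "ccw_labelling N p (R \<union> B)"
begin

section \<open>Chords and the cyclic order of the labels\<close>

lemma inj_p: "inj_on p {..<N}" and image_p: "p ` {..<N} = R \<union> B"
  using labelling by (auto simp: ccw_labelling_def bij_betw_def)

lemma orient_pos: "i < j \<Longrightarrow> j < k \<Longrightarrow> k < N \<Longrightarrow> orient (p i) (p j) (p k) > 0"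
  using labelling by (auto simp: ccw_labelling_def)

lemma p_in: "i < N \<Longrightarrow> p i \<in> R \<union> B"
  using image_p by blast

lemma p_eq_iff: "i < N \<Longrightarrow> j < N \<Longrightarrow> p i = p j \<longleftrightarrow> i = j"
  using inj_p by (auto simp: inj_on_def)

lemma orient_inside:
  assumes "a < x" "x < b" "b < N"
  shows "orient (p a) (p b) (p x) < 0"
  using orient_pos[OF assms] orient_swap[of "p a" "p b" "p x"] by simp

lemma orient_outside:
  assumes "a < b" "b < N" "x < N" "x < a \<or> b < x"
  shows "orient (p a) (p b) (p x) > 0"
  using assms orient_pos[of a b x] orient_pos[of x a b] orient_rotate[of "p a" "p b" "p x"] by auto

text \<open>Interleaved labels put the ends of each chord on opposite sides of the other; rotations
  and swaps reduce all four signs to \<open>orient_pos\<close>.\<close>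

lemma chords_meet:
  assumes "a < x" "x < b" "b < N" "y < N" "y < a \<or> b < y"
  shows "convex hull {p a, p b} \<inter> convex hull {p x, p y} \<noteq> {}"
proof (rule convex_hull_2_meet)
  show "orient (p a) (p b) (p x) < 0" using assms by (intro orient_inside)
  show "orient (p a) (p b) (p y) > 0" using assms by (intro orient_outside) auto
  show "orient (p x) (p y) (p a) > 0"
    using assms orient_pos[of a x y] orient_pos[of y a x]
      orient_rotate[of "p x" "p y" "p a"] orient_rotate[of "p y" "p a" "p x"] by auto
  show "orient (p x) (p y) (p b) < 0"
    using assms orient_pos[of x b y] orient_pos[of y x b]
      orient_swap[of "p x" "p y" "p b"] orient_rotate[of "p x" "p b" "p y"]
      orient_rotate[of "p y" "p x" "p b"] orient_swap[of "p x" "p b" "p y"] by auto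
qed

text \<open>The open label interval from \<open>a\<close> to \<open>b\<close> decides the side of
  the chord, so \<open>p x\<close> and \<open>p y\<close> lie strictly on the same side.\<close>

lemma chords_disjoint:
  assumes "a < b" "b < N" "x < N" "y < N" "x \<notin> {a, b}" "y \<notin> {a, b}"
    and "a < x \<and> x < b \<longleftrightarrow> a < y \<and> y < b"
  shows "convex hull {p a, p b} \<inter> convex hull {p x, p y} = {}"
proof (rule convex_hull_2_disjoint)
  show "orient (p a) (p b) (p x) > 0 \<and> orient (p a) (p b) (p y) > 0 \<or>
        orient (p a) (p b) (p x) < 0 \<and> orient (p a) (p b) (p y) < 0"
  proof (cases "a < x \<and> x < b")
    case True
    then show ?thesis using assms by (auto intro!: orient_inside)
  next
    case False
    then have "x < a \<or> b < x" "y < a \<or> b < y" using assms by auto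
    then show ?thesis using assms by (auto intro!: orient_outside)
  qed
qed

section \<open>Colours and matchings of subsets of the points\<close>

definition colour :: "real^2 \<Rightarrow> int" where
  "colour q = (if q \<in> R then 1 else - 1)"

lemma colour_cases: "colour q = 1 \<or> colour q = - 1"
  by (simp add: colour_def)

text \<open>The value -1 is the default outside \<open>R\<close>; it means blue here because
  labelled points lie in the disjoint union of \<open>R\<close> and \<open>B\<close>.\<close>

lemma colour_neq_iff:
  assumes "i < N" "j < N"
  shows "colour (p i) \<noteq> colour (p j) \<longleftrightarrow> (p i \<in> R \<and> p j \<in> B) \<or> (p i \<in> B \<and> p j \<in> R)"
  using p_in[OF assms(1)] p_in[OF assms(2)] disjoint_colours by (auto simp: colour_def)

text \<open>Restricting both colour classes to an index set allows matchings to be built by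
  induction and glued along a chord.\<close>

abbreviation matching_on :: "nat set \<Rightarrow> (real^2) set set \<Rightarrow> bool" where
  "matching_on S \<equiv> matching (R \<inter> p ` S) (B \<inter> p ` S)"

lemma matching_on_all: "matching_on {..<N} M \<longleftrightarrow> matching R B M"
  by (simp add: image_p inf_sup_aci)

lemma colour_classes_Un: "S \<subseteq> {..<N} \<Longrightarrow> R \<inter> p ` S \<union> B \<inter> p ` S = p ` S"
  using p_in by auto

text \<open>Every edge lies in its convex hull, so disjoint segments already make the edges
  disjoint, and a cover by bichromatic pairs is a partition.\<close>

lemma matching_onI:
  assumes "S \<subseteq> {..<N}" "\<Union>M = p ` S"
    and "\<And>e. e \<in> M \<Longrightarrow> \<exists>u\<in>S. \<exists>v\<in>S. e = {p u, p v} \<and> colour (p u) \<noteq> colour (p v)"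
    and disj: "\<And>e f. e \<in> M \<Longrightarrow> f \<in> M \<Longrightarrow> e \<noteq> f \<Longrightarrow> convex hull e \<inter> convex hull f = {}"
  shows "matching_on S M"
  unfolding matching_def
proof (intro conjI ballI impI)
  have "e \<inter> f = {}" if "e \<in> M" "f \<in> M" "e \<noteq> f" for e f
    using disj[OF that] hull_subset[of e convex] hull_subset[of f convex] by blast
  then show "partition_on (R \<inter> p ` S \<union> B \<inter> p ` S) M"
    using assms(1-3) unfolding partition_on_def disjoint_def
    by (force simp: colour_classes_Un)
next
  fix e assume "e \<in> M"
  then obtain u v where uv: "u \<in> S" "v \<in> S" "e = {p u, p v}" "colour (p u) \<noteq> colour (p v)"
    using assms(3) by blast
  then consider "p u \<in> R" "p v \<in> B" | "p u \<in> B" "p v \<in> R"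
    using colour_neq_iff[of u v] assms(1) by auto
  then show "\<exists>r\<in>R \<inter> p ` S. \<exists>b\<in>B \<inter> p ` S. e = {r, b}"
    using uv by cases (auto simp: insert_commute)
qed (use disj in auto)

lemma matching_on_edgeE:
  assumes "matching_on S M" "e \<in> M" "S \<subseteq> {..<N}"
  obtains u v where "u \<in> S" "v \<in> S" "u < v" "e = {p u, p v}" "colour (p u) \<noteq> colour (p v)"
proof -
  obtain r b where "r \<in> R \<inter> p ` S" "b \<in> B \<inter> p ` S" and e: "e = {r, b}"
    using assms(1)[unfolded matching_def, THEN conjunct2, THEN conjunct1, THEN bspec, OF assms(2)]
    by blast
  then obtain u v where uv: "u \<in> S" "v \<in> S" "r = p u" "b = p v" "p u \<in> R" "p v \<in> B" by auto
  then have col: "colour (p u) \<noteq> colour (p v)"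
    using disjoint_colours by (auto simp: colour_def)
  then have "u \<noteq> v" by auto
  then consider "u < v" | "v < u" by linarith
  then show thesis
    by cases (use that[of u v] that[of v u] uv col e in \<open>auto simp: insert_commute\<close>)
qed

lemma matching_on_Union: "matching_on S M \<Longrightarrow> S \<subseteq> {..<N} \<Longrightarrow> \<Union>M = p ` S"
  by (simp add: matching_def partition_on_def colour_classes_Un)

lemma matching_on_disjoint:
  "matching_on S M \<Longrightarrow> e \<in> M \<Longrightarrow> f \<in> M \<Longrightarrow> e \<noteq> f \<Longrightarrow> convex hull e \<inter> convex hull f = {}"
  by (auto simp: matching_def)

text \<open>The chord from \<open>a\<close> to \<open>b\<close> separates the points of the two
  smaller matchings, so neither crosses it or the other.\<close>

lemma matching_on_combine:
  assumes S: "S \<subseteq> {..<N}" and ab: "a \<in> S" "b \<in> S" "a < b" "colour (p a) \<noteq> colour (p b)"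
    and M1: "matching_on (S \<inter> {a<..<b}) M1" and M2: "matching_on (S - {a..b}) M2"
  shows "matching_on S (insert {p a, p b} (M1 \<union> M2))"
proof -
  let ?S1 = "S \<inter> {a<..<b}" and ?S2 = "S - {a..b}"
  have sub: "?S1 \<subseteq> {..<N}" "?S2 \<subseteq> {..<N}" and N: "a < N" "b < N" using S ab by auto
  have S_eq: "S = insert a (insert b (?S1 \<union> ?S2))" using ab by auto
  have d1: "convex hull {p a, p b} \<inter> convex hull e = {}" if e: "e \<in> M1" for e
  proof -
    obtain u v where "u \<in> ?S1" "v \<in> ?S1" "e = {p u, p v}"
      by (rule matching_on_edgeE[OF M1 e sub(1)])
    then show ?thesis using ab N sub by (simp only:) (rule chords_disjoint; auto)
  qed
  have d2: "convex hull {p a, p b} \<inter> convex hull e = {}" if e: "e \<in> M2" for e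
  proof -
    obtain u v where "u \<in> ?S2" "v \<in> ?S2" "e = {p u, p v}"
      by (rule matching_on_edgeE[OF M2 e sub(2)])
    then show ?thesis using ab N sub by (simp only:) (rule chords_disjoint; auto)
  qed
  \<comment> \<open>Here the inner edge is the reference chord: \<open>x\<close> and
    \<open>y\<close> avoid \<open>{a..b}\<close>, hence both lie outside the interval from
    \<open>u\<close> to \<open>v\<close>.\<close>
  have d12: "convex hull e \<inter> convex hull f = {}" if e: "e \<in> M1" and f: "f \<in> M2" for e f
  proof -
    obtain u v where uv: "u \<in> ?S1" "v \<in> ?S1" "u < v" "e = {p u, p v}"
      by (rule matching_on_edgeE[OF M1 e sub(1)])
    obtain x y where xy: "x \<in> ?S2" "y \<in> ?S2" "f = {p x, p y}"
      by (rule matching_on_edgeE[OF M2 f sub(2)])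
    have "x < N" "y < N" "v < N" using uv xy sub by auto
    then show ?thesis using uv xy by (simp only:) (rule chords_disjoint; auto)
  qed
  show ?thesis
  proof (rule matching_onI[OF S])
    have "p ` S = insert (p a) (insert (p b) (p ` ?S1 \<union> p ` ?S2))"
      by (subst S_eq) blast
    then show "\<Union>(insert {p a, p b} (M1 \<union> M2)) = p ` S"
      using matching_on_Union[OF M1 sub(1)] matching_on_Union[OF M2 sub(2)] by simp
  next
    fix e assume "e \<in> insert {p a, p b} (M1 \<union> M2)"
    then consider "e = {p a, p b}" | "e \<in> M1" | "e \<in> M2" by blast
    then show "\<exists>u\<in>S. \<exists>v\<in>S. e = {p u, p v} \<and> colour (p u) \<noteq> colour (p v)"
    proof cases
      case 1
      then show ?thesis using ab by blast
    next
      case 2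
      from matching_on_edgeE[OF M1 this sub(1)] show ?thesis by (metis IntD1)
    next
      case 3
      from matching_on_edgeE[OF M2 this sub(2)] show ?thesis by (metis DiffD1)
    qed
  next
    fix e f assume "e \<in> insert {p a, p b} (M1 \<union> M2)" "f \<in> insert {p a, p b} (M1 \<union> M2)" "e \<noteq> f"
    then show "convex hull e \<inter> convex hull f = {}"
      using d1 d2 d12 matching_on_disjoint[OF M1] matching_on_disjoint[OF M2]
      by (smt (verit) Int_commute Un_iff insert_iff)
  qed
qed

text \<open>Induction on the size: deleting a bichromatic pair keeps the sum zero, and if the pair
  is consecutive in \<open>S\<close>, its chord can be added back with nothing on its inner
  side.\<close>

lemma balanced_imp_matching_on:
  assumes "S \<subseteq> {..<N}" "(\<Sum>k\<in>S. colour (p k)) = 0"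
  shows "\<exists>M. matching_on S M"
  using assms
proof (induction "card S" arbitrary: S rule: less_induct)
  case less
  have fin: "finite S" using less.prems finite_subset by blast
  show ?case
  proof (cases "S = {}")
    case True
    then show ?thesis by (intro exI[of _ "{}"] matching_onI) auto
  next
    case False
    let ?bi = "\<lambda>x y. x \<in> S \<and> y \<in> S \<and> x < y \<and> colour (p x) \<noteq> colour (p y)"
    obtain z where z: "z \<in> S" using False by blast
    \<comment> \<open>With one colour only, the sum would be plus or minus the nonzero cardinality
      of \<open>S\<close>.\<close>
    have "\<exists>w\<in>S. colour (p w) \<noteq> colour (p z)"
    proof (rule ccontr)
      assume "\<not> ?thesis"
      then have "(\<Sum>k\<in>S. colour (p k)) = (\<Sum>k\<in>S. colour (p z))" by (intro sum.cong) auto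
      then show False using less.prems fin False colour_cases[of "p z"] by auto
    qed
    then obtain w where w: "w \<in> S" "colour (p w) \<noteq> colour (p z)" by blast
    then have "\<exists>x y. ?bi x y"
      using z by (cases w z rule: linorder_cases) metis+
    \<comment> \<open>A closest pair of opposite colours has no point of \<open>S\<close> in between.\<close>
    then have "\<exists>d x y. ?bi x y \<and> y - x = d" by blast
    then obtain a b where ab: "?bi a b" and min: "\<And>x y. ?bi x y \<Longrightarrow> b - a \<le> y - x"
      using ex_has_least_nat[of "\<lambda>(x, y). ?bi x y" _ "\<lambda>(x, y). y - x"] by fast
    have empty: "S \<inter> {a<..<b} = {}"
    proof (rule ccontr)
      assume "S \<inter> {a<..<b} \<noteq> {}"
      then obtain c where c: "c \<in> S" "a < c" "c < b" by auto
      \<comment> \<open>As \<open>a\<close> and \<open>b\<close> differ in colour, \<open>c\<close>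
        differs from one of them and forms a closer pair.\<close>
      then have "?bi a c \<or> ?bi c b" using ab by auto
      then show False using min[of a c] min[of c b] c by auto
    qed
    \<comment> \<open>The gluing lemma removes the whole interval, the colour sum only the pair;
      with nothing in between these agree.\<close>
    have eq: "S - {a..b} = S - {a, b}"
    proof -
      have "{a..b} = {a, b} \<union> {a<..<b}" using ab by auto
      then show ?thesis using empty by blast
    qed
    have "(\<Sum>k\<in>S - {a, b}. colour (p k)) = (\<Sum>k\<in>S. colour (p k)) - (\<Sum>k\<in>{a, b}. colour (p k))"
      using ab fin by (intro sum_diff) auto
    moreover have "colour (p a) + colour (p b) = 0"
      using ab colour_cases[of "p a"] colour_cases[of "p b"] by auto
    ultimately have "(\<Sum>k\<in>S - {a, b}. colour (p k)) = 0" using less.prems ab by simp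
    moreover have "card (S - {a, b}) < card S" using ab fin by (intro psubset_card_mono) auto
    ultimately obtain M2 where "matching_on (S - {a, b}) M2"
      using less.hyps[of "S - {a, b}"] less.prems by blast
    moreover have "matching_on (S \<inter> {a<..<b}) {}"
      unfolding empty by (rule matching_onI) auto
    ultimately show ?thesis
      using matching_on_combine[of S a b "{}" M2] less.prems ab eq by auto
  qed
qed

text \<open>An edge with one end strictly between \<open>a\<close> and \<open>b\<close> cannot cross
  their chord, so its other end is there too. Hence the points between are partitioned by edges,
  each of colour sum zero.\<close>

lemma matching_imp_balanced_between:
  assumes M: "matching R B M" and e: "{p a, p b} \<in> M" and ab: "a < b" "b < N"
  shows "(\<Sum>k\<in>{a<..<b}. colour (p k)) = 0"
proof -
  let ?K = "p ` {a<..<b}"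
  define M' where "M' = {e \<in> M. e \<subseteq> ?K}"
  note M_on = M[folded matching_on_all]
  have part: "partition_on (p ` {..<N}) M"
    using M by (simp add: matching_def image_p)
  have inside: "f \<subseteq> ?K" if f: "f \<in> M" and ne: "f \<inter> ?K \<noteq> {}" for f
  proof -
    obtain u v where uv: "u \<in> {..<N}" "v \<in> {..<N}" "f = {p u, p v}" "u < v"
      by (rule matching_on_edgeE[OF M_on f subset_refl])
    obtain x y where xy: "x < N" "y < N" "f = {p x, p y}" "a < x" "x < b"
    proof -
      obtain k where k: "a < k" "k < b" "p k \<in> f" using ne by auto
      then have "k = u \<or> k = v" using uv ab by (auto simp: p_eq_iff)
      then show thesis using that[of u v] that[of v u] uv k by (auto simp: insert_commute)
    qed
    have "p x \<notin> {p a, p b}" using xy ab by (simp add: p_eq_iff)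
    then have "f \<noteq> {p a, p b}" using xy by blast
    then have disj: "convex hull {p a, p b} \<inter> convex hull f = {}"
      using matching_on_disjoint[OF M_on e f] by simp
    \<comment> \<open>Excludes a shared endpoint, so that \<open>y\<close> not between
      \<open>a\<close> and \<open>b\<close> would be strictly outside, as \<open>chords_meet\<close>
      requires.\<close>
    then have "{p a, p b} \<inter> f = {}"
      using hull_subset[of "{p a, p b}" convex] hull_subset[of f convex] by blast
    then have "y \<noteq> a" "y \<noteq> b" using xy by auto
    then have "a < y \<and> y < b"
      using chords_meet[of a x b y] disj xy ab by (metis linorder_neqE_nat)
    then show ?thesis using xy by auto
  qed
  have "?K \<subseteq> p ` {..<N}" using ab by auto
  then have "?K \<subseteq> \<Union>M" using partition_onD1[OF part] by simp
  moreover have "f \<in> M'" if "q \<in> f" "f \<in> M" "q \<in> ?K" for q f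
    using inside[of f] that unfolding M'_def by blast
  ultimately have "?K \<subseteq> \<Union>M'" by blast
  then have K: "?K = \<Union>M'" unfolding M'_def by (intro equalityI) auto
  have "inj_on p {a<..<b}"
    using ab by (intro inj_on_subset[OF inj_p]) auto
  then have "(\<Sum>k\<in>{a<..<b}. colour (p k)) = sum colour ?K"
    by (simp add: sum.reindex)
  also have "\<dots> = (\<Sum>f\<in>M'. sum colour f)"
  proof -
    have "finite f" if "f \<in> M'" for f
      using that K by (metis Union_upper finite_greaterThanLessThan finite_imageI finite_subset)
    moreover have "f \<inter> g = {}" if "f \<in> M'" "g \<in> M'" "f \<noteq> g" for f g
      using that partition_onD2[OF part] by (auto simp: M'_def disjoint_def)
    ultimately show ?thesis unfolding K by (subst sum.Union_disjoint) auto
  qed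
  also have "\<dots> = 0"
  proof (rule sum.neutral, rule ballI)
    fix f assume "f \<in> M'"
    then have "f \<in> M" by (simp add: M'_def)
    from matching_on_edgeE[OF M_on this subset_refl]
    obtain u v where uv: "u \<in> {..<N}" "v \<in> {..<N}" "u < v" "f = {p u, p v}"
      "colour (p u) \<noteq> colour (p v)" .
    then show "sum colour f = 0"
      using colour_cases[of "p u"] colour_cases[of "p v"] by (auto simp: p_eq_iff)
  qed
  finally show ?thesis .
qed

section \<open>Feasible pairs as balanced chords\<close>

lemma total_colour: "(\<Sum>k<N. colour (p k)) = 0"
proof -
  have "(\<Sum>k<N. colour (p k)) = sum colour (R \<union> B)"
    using inj_p by (simp add: sum.reindex flip: image_p)
  also have "\<dots> = sum colour R + sum colour B"
    using finite_colours disjoint_colours by (intro sum.union_disjoint) auto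
  also have "sum colour R = int (card R)" by (simp add: colour_def)
  also have "sum colour B = (\<Sum>q\<in>B. - 1)"
    using disjoint_colours by (intro sum.cong) (auto simp: colour_def)
  finally show ?thesis using balanced by simp
qed

text \<open>For the converse, the total is zero and the two ends cancel, so the points outside are
  balanced as well; both sides are matched separately and glued along the chord.\<close>

lemma feasible_iff_balanced_between:
  assumes ab: "a < b" "b < N"
  shows "feasible R B (p a) (p b) \<longleftrightarrow>
    colour (p a) \<noteq> colour (p b) \<and> (\<Sum>k\<in>{a<..<b}. colour (p k)) = 0"
proof
  assume "feasible R B (p a) (p b)"
  then obtain M where M: "matching R B M" "{p a, p b} \<in> M" by (auto simp: feasible_def)
  obtain u v where uv: "{p a, p b} = {p u, p v}" "colour (p u) \<noteq> colour (p v)"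
    by (rule matching_on_edgeE[OF M(1)[folded matching_on_all] M(2) subset_refl])
  then have "colour (p a) \<noteq> colour (p b)" by (auto simp: doubleton_eq_iff)
  then show "colour (p a) \<noteq> colour (p b) \<and> (\<Sum>k\<in>{a<..<b}. colour (p k)) = 0"
    using matching_imp_balanced_between[OF M ab] by simp
next
  assume R: "colour (p a) \<noteq> colour (p b) \<and> (\<Sum>k\<in>{a<..<b}. colour (p k)) = 0"
  have split: "{..<N} = insert a (insert b (({..<N} \<inter> {a<..<b}) \<union> ({..<N} - {a..b})))"
    using ab by auto
  have in_eq: "{..<N} \<inter> {a<..<b} = {a<..<b}" using ab by auto
  have "(\<Sum>k<N. colour (p k)) =
    colour (p a) + (colour (p b) + ((\<Sum>k\<in>{a<..<b}. colour (p k)) + (\<Sum>k\<in>{..<N} - {a..b}. colour (p k))))"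
    using ab by (subst split, subst sum.insert, simp, simp, subst sum.insert, simp, simp,
        subst sum.union_disjoint) (auto simp: in_eq)
  moreover have "colour (p a) + colour (p b) = 0"
    using R colour_cases[of "p a"] colour_cases[of "p b"] by auto
  ultimately have out: "(\<Sum>k\<in>{..<N} - {a..b}. colour (p k)) = 0"
    using total_colour R by simp
  obtain M1 where "matching_on ({..<N} \<inter> {a<..<b}) M1"
    using balanced_imp_matching_on[of "{..<N} \<inter> {a<..<b}"] R in_eq Int_lower1 by metis
  moreover obtain M2 where "matching_on ({..<N} - {a..b}) M2"
    using balanced_imp_matching_on[OF Diff_subset out] by blast
  ultimately have "matching_on {..<N} (insert {p a, p b} (M1 \<union> M2))"
    using ab R by (intro matching_on_combine) auto
  then show "feasible R B (p a) (p b)"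
    unfolding feasible_def matching_on_all by blast
qed

section \<open>Levels of the closed walk\<close>

text \<open>\<open>height m\<close> is the position before step \<open>m\<close>. Reducing labels
  modulo \<open>N\<close> lets the walk run past the last point, so going round needs no case
  split.\<close>

definition height :: "nat \<Rightarrow> int" where
  "height m = (\<Sum>k<m. colour (p (k mod N)))"

definition level :: "nat \<Rightarrow> int" where
  "level m = min (height m) (height (Suc m))"

lemma height_Suc: "height (Suc m) = height m + colour (p (m mod N))"
  by (simp add: height_def)

lemma height_add_period: "height (m + N) = height m"
proof (induction m)
  case 0
  have "height N = (\<Sum>k<N. colour (p k))" unfolding height_def by (intro sum.cong) auto
  then show ?case using total_colour by (simp add: height_def)
qed (simp add: height_Suc)

lemma level_add_period: "level (m + N) = level m"
  using height_add_period[of m] height_add_period[of "Suc m"] by (simp add: level_def)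

lemma level_mod [simp]: "level (m mod N) = level m"
proof -
  have "level (r + k * N) = level r" for r k
  proof (induction k)
    case (Suc k)
    have "r + Suc k * N = (r + k * N) + N" by simp
    then show ?case using Suc level_add_period by metis
  qed simp
  from this[of "m mod N" "m div N"] show ?thesis by simp
qed

text \<open>For \<open>a < b\<close> the colour sum between is
  \<open>height b - height (Suc a)\<close>. If the steps are opposite, these two heights are both
  upper ends or both lower ends, so they agree iff the levels do.\<close>

lemma feasible_iff_level:
  assumes "x < N" "y < N"
  shows "feasible R B (p x) (p y) \<longleftrightarrow> colour (p x) \<noteq> colour (p y) \<and> level x = level y"
proof -
  have less: "feasible R B (p a) (p b) \<longleftrightarrow> colour (p a) \<noteq> colour (p b) \<and> level a = level b"
    if ab: "a < b" "b < N" for a b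
  proof -
    have split: "{..<b} = {..<Suc a} \<union> {a<..<b}" using ab by auto
    have "height b = height (Suc a) + (\<Sum>k\<in>{a<..<b}. colour (p (k mod N)))"
      unfolding height_def by (subst split, subst sum.union_disjoint) auto
    also have "(\<Sum>k\<in>{a<..<b}. colour (p (k mod N))) = (\<Sum>k\<in>{a<..<b}. colour (p k))"
      using ab by (intro sum.cong) auto
    finally have "(\<Sum>k\<in>{a<..<b}. colour (p k)) = height b - height (Suc a)" by simp
    moreover have "level a = level b \<longleftrightarrow> height b = height (Suc a)"
      if "colour (p a) \<noteq> colour (p b)"
      using that ab colour_cases[of "p a"] colour_cases[of "p b"]
      by (auto simp: level_def height_Suc)
    ultimately show ?thesis using feasible_iff_balanced_between[OF ab] by auto
  qed
  have sym: "feasible R B (p x) (p y) \<longleftrightarrow> feasible R B (p y) (p x)"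
    by (simp add: feasible_def insert_commute)
  consider "x < y" | "y < x" | "x = y" by linarith
  then show ?thesis
  proof cases
    case 3
    \<comment> \<open>The set \<open>{p x, p x}\<close> is a singleton, whereas an edge has ends of
      two colours.\<close>
    have "\<not> feasible R B (p x) (p x)"
    proof
      assume "feasible R B (p x) (p x)"
      then obtain M where M: "matching R B M" "{p x, p x} \<in> M" by (auto simp: feasible_def)
      show False
        by (rule matching_on_edgeE[OF M(1)[folded matching_on_all] M(2) subset_refl])
          (auto simp: doubleton_eq_iff)
    qed
    then show ?thesis using 3 by simp
  qed (use less[of x y] less[of y x] sym assms in auto)
qed

text \<open>A discrete intermediate value argument: before repeating the same step the walk must
  come back to its starting height, and it first does so by the opposite step of that level.\<close>

lemma opposite_step_same_level:
  assumes "0 < d" "level (x + d) = level x"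
  obtains d' where "0 < d'" "d' \<le> d" "level (x + d') = level x"
    "colour (p ((x + d') mod N)) \<noteq> colour (p (x mod N))"
proof (cases "colour (p ((x + d) mod N)) = colour (p (x mod N))")
  case False
  then show thesis using that assms by blast
next
  case True
  define s where "s = colour (p (x mod N))"
  have s: "s = 1 \<or> s = - 1" using colour_cases by (simp add: s_def)
  have Suc_x: "height (Suc x) = height x + s" by (simp add: height_Suc s_def)
  \<comment> \<open>Equal steps with equal lower ends start at the same height.\<close>
  have "height (x + d) = height x"
    using assms True s by (auto simp: level_def height_Suc s_def)
  then have ex: "0 < d \<and> s * height (x + d) \<le> s * height x" using assms by simp
  \<comment> \<open>The first return to the starting height or beyond it; the factor
    \<open>s\<close> treats upward and downward steps at once.\<close>
  define e where "e = (LEAST e. 0 < e \<and> s * height (x + e) \<le> s * height x)"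
  have e: "0 < e" "s * height (x + e) \<le> s * height x" "e \<le> d"
    using LeastI[of "\<lambda>e. 0 < e \<and> s * height (x + e) \<le> s * height x", OF ex]
      Least_le[of "\<lambda>e. 0 < e \<and> s * height (x + e) \<le> s * height x", OF ex]
    by (auto simp: e_def)
  \<comment> \<open>The first step moves away, so the step \<open>d'\<close> that ends at time
    \<open>e\<close> is a later one.\<close>
  have "e \<noteq> 1" using e s Suc_x by auto
  then obtain d' where d': "e = Suc d'" "0 < d'" using e by (cases e) auto
  have "\<not> s * height (x + d') \<le> s * height x"
    using not_less_Least[of d' "\<lambda>e. 0 < e \<and> s * height (x + e) \<le> s * height x"] d'
    unfolding e_def[symmetric] by auto
  moreover have "height (x + e) = height (x + d') + colour (p ((x + d') mod N))"
    by (simp add: d' height_Suc)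
  \<comment> \<open>Steps have size one, so passing from strictly beyond to not beyond fixes both
    heights and the direction.\<close>
  ultimately have "height (x + d') = height x + s" "height (x + e) = height x"
    "colour (p ((x + d') mod N)) = - s"
    using e s colour_cases[of "p ((x + d') mod N)"] by auto
  then show thesis
    using that[of d'] d' e s Suc_x by (auto simp: level_def s_def)
qed

section \<open>Orbits of the first feasible point\<close>

abbreviation "next_point \<equiv> first_feasible N p R B"

text \<open>The opposite step found at distance at most \<open>d\<close> is feasible, so the least
  feasible distance exists and does not exceed \<open>d\<close>.\<close>

lemma next_point_level:
  assumes x: "x < N" and d: "0 < d" "level (x + d) = level x"
  obtains D where "0 < D" "D \<le> d" "next_point x = (x + D) mod N" "level (x + D) = level x"
proof -
  let ?Q = "\<lambda>d. 0 < d \<and> feasible R B (p x) (p ((x + d) mod N))"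
  obtain d' where d': "0 < d'" "d' \<le> d" "level (x + d') = level x"
      "colour (p ((x + d') mod N)) \<noteq> colour (p (x mod N))"
    using opposite_step_same_level[OF d] .
  then have "?Q d'" using x N_pos by (simp add: feasible_iff_level)
  then have "?Q (Least ?Q)" "Least ?Q \<le> d'" by (rule LeastI, rule Least_le)
  then show thesis
    using that[of "Least ?Q"] d' x N_pos by (simp add: first_feasible_def feasible_iff_level)
qed

lemma next_point_less: "next_point x < N"
  using N_pos by (simp add: first_feasible_def)

text \<open>A full turn, \<open>d = N\<close>, always provides a point of the same level
  ahead.\<close>

lemma level_next_point: "x < N \<Longrightarrow> level (next_point x) = level x"
  using next_point_level[of x N] N_pos level_add_period by (metis level_mod)

text \<open>Induction on the distance: one application of \<open>next_point\<close> stays on the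
  level and never overshoots, leaving the shorter distance \<open>d - D\<close>.\<close>

lemma same_level_reachable_dist:
  assumes "0 < d" "x < N" "level (x + d) = level x"
  shows "\<exists>k. (next_point ^^ Suc k) x = (x + d) mod N"
  using assms
proof (induction d arbitrary: x rule: less_induct)
  case (less d)
  from next_point_level[OF less.prems(2,1,3)]
  obtain D where D: "0 < D" "D \<le> d" "next_point x = (x + D) mod N" "level (x + D) = level x" .
  show ?case
  proof (cases "D = d")
    case True
    then show ?thesis using D by (intro exI[of _ 0]) simp
  next
    case False
    have "((x + D) mod N + (d - D)) mod N = (x + D + (d - D)) mod N"
      by (rule mod_add_left_eq)
    then have "((x + D) mod N + (d - D)) mod N = (x + d) mod N"
      using D by simp
    then have step: "(next_point x + (d - D)) mod N = (x + d) mod N"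
      by (simp add: D)
    then have "level (next_point x + (d - D)) = level (next_point x)"
      using less.prems D(3,4) by (metis level_mod)
    moreover have "d - D < d" "0 < d - D" using False D less.prems(1) by auto
    ultimately obtain k where "(next_point ^^ Suc k) (next_point x) = (x + d) mod N"
      using less.IH[of "d - D" "next_point x"] next_point_less step by metis
    then have "(next_point ^^ Suc (Suc k)) x = (x + d) mod N"
      by (simp add: funpow_swap1)
    then show ?thesis by blast
  qed
qed

text \<open>The distance \<open>y + N - x\<close> is positive even for \<open>y \<le> x\<close>; for
  \<open>y = x\<close> it is a full turn, so a positive iterate returns to its start.\<close>

lemma same_level_reachable:
  assumes "x < N" "y < N" "level x = level y"
  obtains k where "(next_point ^^ Suc k) x = y"
proof -
  have "x + (y + N - x) = y + N" using assms by simp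
  then show thesis
    using same_level_reachable_dist[of "y + N - x" x] assms that
    by (auto simp: level_add_period)
qed

lemma funpow_next_point:
  "x < N \<Longrightarrow> (next_point ^^ k) x < N \<and> level ((next_point ^^ k) x) = level x"
  by (induction k) (auto simp: next_point_less level_next_point)

text \<open>Some positive iterate fixes \<open>x\<close>, so \<open>x\<close> is the image of the
  iterate just before it.\<close>

lemma next_point_surj: "next_point ` {..<N} = {..<N}"
proof
  show "{..<N} \<subseteq> next_point ` {..<N}"
  proof
    fix x assume "x \<in> {..<N}"
    then obtain k where "next_point ((next_point ^^ k) x) = x" "x < N"
      using same_level_reachable[of x x] by auto
    then show "x \<in> next_point ` {..<N}"
      using funpow_next_point[of x k] by (metis image_eqI lessThan_iff)
  qed
qed (use next_point_less in auto)

text \<open>By surjectivity \<open>inv_into\<close> is a right inverse, so level preservation by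
  \<open>next_point\<close> passes to backward steps.\<close>

lemma funpow_inv_next_point:
  "x < N \<Longrightarrow> (inv_into {..<N} next_point ^^ k) x < N \<and>
    level ((inv_into {..<N} next_point ^^ k) x) = level x"
proof (induction k)
  case (Suc k)
  let ?y = "(inv_into {..<N} next_point ^^ k) x"
  have y: "?y \<in> next_point ` {..<N}" using Suc next_point_surj by simp
  have "inv_into {..<N} next_point ?y < N"
    using inv_into_into[OF y] by simp
  moreover have "next_point (inv_into {..<N} next_point ?y) = ?y"
    by (rule f_inv_into_f[OF y])
  ultimately show ?case using Suc level_next_point by (metis comp_apply funpow.simps(2))
qed simp

text \<open>Iterates in both directions stay on the level, and the forward ones already reach all of
  it.\<close>

lemma feasible_orbit_eq:
  assumes x: "x < N"
  shows "feasible_orbit N p R B x = {y. y < N \<and> level y = level x}"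
proof (intro equalityI subsetI)
  fix y assume "y \<in> feasible_orbit N p R B x"
  then show "y \<in> {y. y < N \<and> level y = level x}"
    using funpow_next_point[OF x] funpow_inv_next_point[OF x]
    by (auto simp: feasible_orbit_def int_iterate_def)
next
  fix y assume "y \<in> {y. y < N \<and> level y = level x}"
  then obtain k where "(next_point ^^ Suc k) x = y"
    using same_level_reachable[of x y] x by auto
  then have "y = int_iterate {..<N} next_point (int (Suc k)) x"
    unfolding int_iterate_def nat_int by simp
  then show "y \<in> feasible_orbit N p R B x"
    unfolding feasible_orbit_def by (rule range_eqI)
qed

lemma feasible_orbit_eq_iff:
  "x < N \<Longrightarrow> y < N \<Longrightarrow>
    feasible_orbit N p R B x = feasible_orbit N p R B y \<longleftrightarrow> level x = level y"
  by (auto simp: feasible_orbit_eq)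

end

theorem proposition6:
  fixes n :: nat and R B :: "(real^2) set" and p :: "nat \<Rightarrow> real^2" and i j :: nat
  assumes "n \<ge> 1"
    and "R \<inter> B = {}" and "finite R" and "finite B" and "card R = n" and "card B = n"
    and "convex_position (R \<union> B)"
    and "ccw_labelling (2 * n) p (R \<union> B)"
    and "i < 2 * n" and "j < 2 * n"
  shows "feasible R B (p i) (p j) \<longleftrightarrow>
     ((p i \<in> R \<and> p j \<in> B) \<or> (p i \<in> B \<and> p j \<in> R)) \<and>
     feasible_orbit (2 * n) p R B i = feasible_orbit (2 * n) p R B j"
proof -
  interpret bichromatic_polygon "2 * n" R B p
    using assms by unfold_locales auto
  show ?thesis
    using feasible_iff_level[of i j] colour_neq_iff[of i j] feasible_orbit_eq_iff[of i j] assms(9,10)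
    by simp
qed

end
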